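(* Let $K\subset\mathbb{R}^n$ be a closed convex set, $\mu_0\in K$, $h\in\mathbb{R}^n$ (a realization of a standard Gaussian vector). For $\sigma\ge0$ let $\hat\mu_K^{\mathrm{seq}}(\sigma)=\Pi_K(\mu_0+\sigma h)$, $\mathrm{err}(\sigma)=\|\hat\mu_K^{\mathrm{seq}}(\sigma)-\mu_0\|^2$ and $\mathrm{lrt}(\sigma)=\|\sigma h\|^2-\|\mu_0+\sigma h-\hat\mu_K^{\mathrm{seq}}(\sigma)\|^2$. The following hold. (1) For any $\sigma>0$, $\mathrm{lrt}(\sigma)-\sigma\cdot\mathrm{lrt}'(\sigma)=-\mathrm{err}(\sigma)$. (2) For any (possibly depending on $h$) $\nu\in\mathbb{R}^n$ such that $K+\nu\subset K$ and $\hat\mu_K^{\mathrm{seq}}(\sigma)-\nu\in K$, $$\mathrm{lrt}(\sigma)=\min_{s\in\mathbb{R}^n}\big\{\|\sigma h-s\|^2-2\big(s^\top(\mu_0-\nu)-\mathbf{0}_K^*(s)\big)\big\},$$ where $\mathbf{0}_K^*(s)=\sup_{t\in K}t^\top s$ is the support function of $K$. (3) $(\mathrm{lrt}(\sigma)/\sigma)'=\mathrm{err}(\sigma)/\sigma^2$ for $\sigma>0$, so $\sigma\mapsto\mathrm{lrt}(\sigma)/\sigma$ is non-decreasing and concave on $(0,\infty)$. (4) The map $\sigma\mapsto\mathrm{lrt}(\sigma)/\sigma^2$ is non-increasing on $(0,\infty)$.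
   Context: $\Pi_K$ is the metric projection onto $K$; $\|\cdot\|$ is the Euclidean norm. *)

theory Defs
  imports "HOL-Analysis.Analysis"
begin

definition mu_seq :: "(real^'n) set \<Rightarrow> real^'n \<Rightarrow> real^'n \<Rightarrow> real \<Rightarrow> real^'n" where
  "mu_seq K \<mu>0 h \<sigma> = closest_point K (\<mu>0 + \<sigma> *\<^sub>R h)"

definition err :: "(real^'n) set \<Rightarrow> real^'n \<Rightarrow> real^'n \<Rightarrow> real \<Rightarrow> real" where
  "err K \<mu>0 h \<sigma> = (norm (mu_seq K \<mu>0 h \<sigma> - \<mu>0))\<^sup>2"

definition lrt :: "(real^'n) set \<Rightarrow> real^'n \<Rightarrow> real^'n \<Rightarrow> real \<Rightarrow> real" where
  "lrt K \<mu>0 h \<sigma> =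
     (norm (\<sigma> *\<^sub>R h))\<^sup>2 - (norm (\<mu>0 + \<sigma> *\<^sub>R h - mu_seq K \<mu>0 h \<sigma>))\<^sup>2"

(* Extended-real valued: the supremum is infinite in some directions when K is unbounded. *)
definition support_function :: "(real^'n) set \<Rightarrow> real^'n \<Rightarrow> ereal" where
  "support_function K s = (SUP t\<in>K. ereal (t \<bullet> s))"

(* For K nonempty the support function never takes the value -\<infinity>, so the objective is
   real or +\<infinity>. *)
definition dual_objective ::
  "(real^'n) set \<Rightarrow> real^'n \<Rightarrow> real^'n \<Rightarrow> real \<Rightarrow> real^'n \<Rightarrow> real^'n \<Rightarrow> ereal" where
  "dual_objective K \<mu>0 h \<sigma> \<nu> s =
     ereal ((norm (\<sigma> *\<^sub>R h - s))\<^sup>2) - 2 * (ereal (s \<bullet> (\<mu>0 - \<nu>)) - support_function K s)"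

end

theory Submission
  imports Defs
begin

text \<open>
  Put \<open>d \<sigma> = mu_seq K \<mu>0 h \<sigma> - \<mu>0\<close>. Then \<open>lrt \<sigma> = 2 \<sigma> (h \<bullet> d \<sigma>) - \<parallel>d \<sigma>\<parallel>\<^sup>2\<close> is the maximum of
  \<open>2 \<sigma> (h \<bullet> (x - \<mu>0)) - \<parallel>x - \<mu>0\<parallel>\<^sup>2\<close> over \<open>x \<in> K\<close>. Testing the maximum at \<open>\<tau>\<close> with the maximiser
  at \<open>\<sigma>\<close> bounds \<open>lrt \<tau> / \<tau>\<close> from below by a function that is smooth in \<open>\<tau>\<close>; the dual problem, whose
  minimiser is the residual \<open>\<mu>0 + \<sigma> h - mu_seq K \<mu>0 h \<sigma>\<close>, becomes affine in \<open>\<tau>\<close> after rescaling the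
  dual variable, which bounds \<open>lrt \<tau> / \<tau>\<close> from above by a line. The two bounds touch at \<open>\<tau> = \<sigma>\<close> with
  common slope \<open>err \<sigma> / \<sigma>\<^sup>2\<close>. This squeezes the derivative, and the lines give concavity.
\<close>

lemma has_real_derivative_squeeze:
  fixes f l u :: "real \<Rightarrow> real"
  assumes l: "(l has_real_derivative D) (at x)" and u: "(u has_real_derivative D) (at x)"
    and le: "\<forall>\<^sub>F y in at x. l y \<le> f y \<and> f y \<le> u y"
    and eq: "l x = f x" "u x = f x"
  shows "(f has_real_derivative D) (at x)"
proof -
  have L: "((\<lambda>y. (l y - f x) / (y - x)) \<longlongrightarrow> D) (at x)"
    and U: "((\<lambda>y. (u y - f x) / (y - x)) \<longlongrightarrow> D) (at x)"
    using l u eq by (simp_all add: has_field_derivative_iff)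
  have "((\<lambda>y. (f y - f x) / (y - x)) \<longlongrightarrow> D) (at x)"
  proof (rule tendsto_sandwich)
    \<comment> \<open>Division by \<open>y - x\<close> reverses the order for \<open>y < x\<close>,
      so the quotients of \<open>l\<close> and \<open>u\<close> swap roles; their \<open>min\<close>
      and \<open>max\<close> serve as bounds on both sides.\<close>
    show "((\<lambda>y. min ((l y - f x) / (y - x)) ((u y - f x) / (y - x))) \<longlongrightarrow> D) (at x)"
      using tendsto_min[OF L U] by simp
    show "((\<lambda>y. max ((l y - f x) / (y - x)) ((u y - f x) / (y - x))) \<longlongrightarrow> D) (at x)"
      using tendsto_max[OF L U] by simp
    have b: "min (a / z) (c / z) \<le> b / z \<and> b / z \<le> max (a / z) (c / z)"
      if "a \<le> b" "b \<le> c" for a b c z :: real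
      using divide_right_mono[of a b z] divide_right_mono[of b c z]
        divide_right_mono_neg[of a b z] divide_right_mono_neg[of b c z] that
      by (cases "z \<ge> 0") auto
    show "\<forall>\<^sub>F y in at x. min ((l y - f x) / (y - x)) ((u y - f x) / (y - x)) \<le> (f y - f x) / (y - x)"
      using le by eventually_elim (use b in auto)
    show "\<forall>\<^sub>F y in at x. (f y - f x) / (y - x) \<le> max ((l y - f x) / (y - x)) ((u y - f x) / (y - x))"
      using le by eventually_elim (use b in auto)
  qed
  then show ?thesis by (simp add: has_field_derivative_iff)
qed

text \<open>Taking the convex combination itself as base point, the weighted sum of the two tangent
  inequalities loses its linear term.\<close>

lemma concave_on_if_below_tangents:
  fixes f D :: "real \<Rightarrow> real"
  assumes "convex S" and tangent: "\<And>x y. x \<in> S \<Longrightarrow> y \<in> S \<Longrightarrow> f y \<le> f x + D x * (y - x)"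
  shows "concave_on S f"
  unfolding concave_on_iff
proof (intro conjI ballI allI impI)
  fix x y u v :: real
  assume xy: "x \<in> S" "y \<in> S" and uv: "u \<ge> 0" "v \<ge> 0" "u + v = 1"
  define z where "z = u *\<^sub>R x + v *\<^sub>R y"
  have z: "z \<in> S" unfolding z_def using \<open>convex S\<close> xy uv by (intro convexD)
  have "u * f x + v * f y \<le> u * (f z + D z * (x - z)) + v * (f z + D z * (y - z))"
    using tangent[OF z] xy uv by (intro add_mono mult_left_mono) auto
  also have "\<dots> = (u + v) * f z + D z * (u * x + v * y - (u + v) * z)"
    by (simp add: algebra_simps)
  also have "\<dots> = f z" using uv by (simp add: z_def)
  finally show "u * f x + v * f y \<le> f (u *\<^sub>R x + v *\<^sub>R y)" by (simp add: z_def)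
qed fact

context
  fixes K :: "(real^'n) set" and \<mu>0 h :: "real^'n"
  assumes K: "closed K" "convex K" "\<mu>0 \<in> K"
begin

lemma mu_seq_in: "mu_seq K \<mu>0 h \<sigma> \<in> K"
  unfolding mu_seq_def using K by (intro closest_point_in_set) auto

text \<open>The residual of a projection lies in the normal cone of \<open>K\<close> at the
  projected point.\<close>

lemma mu_seq_obtuse:
  assumes "x \<in> K"
  shows "(\<mu>0 + \<sigma> *\<^sub>R h - mu_seq K \<mu>0 h \<sigma>) \<bullet> (x - mu_seq K \<mu>0 h \<sigma>) \<le> 0"
  unfolding mu_seq_def using K assms by (intro closest_point_dot) auto

lemma lrt_eq:
  "lrt K \<mu>0 h \<sigma> = 2 * \<sigma> * (h \<bullet> (mu_seq K \<mu>0 h \<sigma> - \<mu>0)) - err K \<mu>0 h \<sigma>"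
  unfolding lrt_def err_def power2_norm_eq_inner
  by (simp add: inner_simps inner_commute algebra_simps)

text \<open>Every \<open>x\<close> in \<open>K\<close> competes with the projection for the smallest
  distance. By \<open>lrt_eq\<close>, the projection itself attains equality.\<close>

lemma lrt_ge:
  assumes "x \<in> K"
  shows "lrt K \<mu>0 h \<sigma> \<ge> 2 * \<sigma> * (h \<bullet> (x - \<mu>0)) - (norm (x - \<mu>0))\<^sup>2"
proof -
  have "norm (\<mu>0 + \<sigma> *\<^sub>R h - mu_seq K \<mu>0 h \<sigma>) \<le> norm (\<mu>0 + \<sigma> *\<^sub>R h - x)"
    using closest_point_le[OF \<open>closed K\<close> assms, of "\<mu>0 + \<sigma> *\<^sub>R h"]
    by (simp add: mu_seq_def dist_norm)
  then have "(norm (\<mu>0 + \<sigma> *\<^sub>R h - mu_seq K \<mu>0 h \<sigma>))\<^sup>2 \<le> (norm (\<mu>0 + \<sigma> *\<^sub>R h - x))\<^sup>2"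
    by (simp add: power_mono)
  moreover have "(norm (\<sigma> *\<^sub>R h))\<^sup>2 - (norm (\<mu>0 + \<sigma> *\<^sub>R h - x))\<^sup>2
      = 2 * \<sigma> * (h \<bullet> (x - \<mu>0)) - (norm (x - \<mu>0))\<^sup>2"
    unfolding power2_norm_eq_inner
    by (simp add: inner_simps inner_commute algebra_simps)
  ultimately show ?thesis unfolding lrt_def by linarith
qed

lemma lrt_div_ge:
  assumes "\<sigma> > 0" "\<tau> > 0"
  shows "lrt K \<mu>0 h \<tau> / \<tau> \<ge> lrt K \<mu>0 h \<sigma> / \<sigma> + err K \<mu>0 h \<sigma> * (1 / \<sigma> - 1 / \<tau>)"
proof -
  have "lrt K \<mu>0 h \<sigma> / \<sigma> + err K \<mu>0 h \<sigma> * (1 / \<sigma> - 1 / \<tau>)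
      = (2 * \<tau> * (h \<bullet> (mu_seq K \<mu>0 h \<sigma> - \<mu>0)) - err K \<mu>0 h \<sigma>) / \<tau>"
    unfolding lrt_eq using assms by (simp add: field_simps)
  also have "\<dots> \<le> lrt K \<mu>0 h \<tau> / \<tau>"
    using lrt_ge[OF mu_seq_in, of \<tau> \<sigma>] assms by (simp add: err_def divide_right_mono)
  finally show ?thesis .
qed

lemma lrt_div_le:
  assumes "\<sigma> > 0" "\<tau> > 0"
  shows "lrt K \<mu>0 h \<tau> / \<tau> \<le> lrt K \<mu>0 h \<sigma> / \<sigma> + err K \<mu>0 h \<sigma> / \<sigma>\<^sup>2 * (\<tau> - \<sigma>)"
proof -
  define d e r where "d = mu_seq K \<mu>0 h \<sigma> - \<mu>0" and "e = mu_seq K \<mu>0 h \<tau> - \<mu>0" and "r = \<tau> / \<sigma>"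
  have \<tau>: "\<tau> = r * \<sigma>" and r: "r > 0" using assms by (auto simp: r_def)
  have "(\<sigma> *\<^sub>R h - d) \<bullet> (e - d) \<le> 0"
    using mu_seq_obtuse[OF mu_seq_in, of \<sigma> \<tau>] by (simp add: d_def e_def algebra_simps)
  \<comment> \<open>The right-hand side is the duality gap at \<open>\<tau>\<close>: the dual value
    (shift zero) at \<open>r\<close> times the residual \<open>\<sigma> *\<^sub>R h - d\<close>,
    minus \<open>lrt\<close> at \<open>\<tau>\<close>. After division by \<open>\<tau>\<close> that
    dual value is affine in \<open>\<tau>\<close>.\<close>
  then have "0 \<le> (norm (e - r *\<^sub>R d))\<^sup>2 - 2 * r * ((\<sigma> *\<^sub>R h - d) \<bullet> (e - d))"
    using r by (smt (verit) mult_nonneg_nonpos zero_le_power2)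
  also have "\<dots> = (r * (r * (d \<bullet> d)) + 2 * \<tau> * (h \<bullet> d) - 2 * r * (d \<bullet> d))
      - (2 * \<tau> * (h \<bullet> e) - e \<bullet> e)"
    unfolding power2_norm_eq_inner \<tau> by (simp add: inner_simps inner_commute algebra_simps)
  finally have "lrt K \<mu>0 h \<tau> \<le> r * (r * (d \<bullet> d)) + 2 * \<tau> * (h \<bullet> d) - 2 * r * (d \<bullet> d)"
    by (simp add: lrt_eq err_def e_def power2_norm_eq_inner)
  then have "lrt K \<mu>0 h \<tau> / \<tau> \<le> (r * (r * (d \<bullet> d)) + 2 * \<tau> * (h \<bullet> d) - 2 * r * (d \<bullet> d)) / \<tau>"
    using assms by (simp add: divide_right_mono)
  also have "\<dots> = lrt K \<mu>0 h \<sigma> / \<sigma> + err K \<mu>0 h \<sigma> / \<sigma>\<^sup>2 * (\<tau> - \<sigma>)"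
    using assms r unfolding lrt_eq err_def d_def[symmetric] power2_norm_eq_inner \<tau>
    by (simp add: field_simps power2_eq_square)
  finally show ?thesis .
qed

lemma lrt_div_has_derivative:
  assumes "\<sigma> > 0"
  shows "((\<lambda>\<tau>. lrt K \<mu>0 h \<tau> / \<tau>) has_real_derivative err K \<mu>0 h \<sigma> / \<sigma>\<^sup>2) (at \<sigma>)"
proof (rule has_real_derivative_squeeze)
  show "((\<lambda>\<tau>. lrt K \<mu>0 h \<sigma> / \<sigma> + err K \<mu>0 h \<sigma> * (1 / \<sigma> - 1 / \<tau>))
      has_real_derivative err K \<mu>0 h \<sigma> / \<sigma>\<^sup>2) (at \<sigma>)"
    by (rule derivative_eq_intros refl)+ (use assms in \<open>auto simp: power2_eq_square\<close>)
  show "((\<lambda>\<tau>. lrt K \<mu>0 h \<sigma> / \<sigma> + err K \<mu>0 h \<sigma> / \<sigma>\<^sup>2 * (\<tau> - \<sigma>))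
      has_real_derivative err K \<mu>0 h \<sigma> / \<sigma>\<^sup>2) (at \<sigma>)"
    using assms by (auto intro!: derivative_eq_intros simp: field_simps power2_eq_square)
  have "\<forall>\<^sub>F \<tau> in at \<sigma>. \<tau> > 0"
    using assms by (rule order_tendstoD[OF tendsto_ident_at])
  then show "\<forall>\<^sub>F \<tau> in at \<sigma>.
      lrt K \<mu>0 h \<sigma> / \<sigma> + err K \<mu>0 h \<sigma> * (1 / \<sigma> - 1 / \<tau>) \<le> lrt K \<mu>0 h \<tau> / \<tau> \<and>
      lrt K \<mu>0 h \<tau> / \<tau> \<le> lrt K \<mu>0 h \<sigma> / \<sigma> + err K \<mu>0 h \<sigma> / \<sigma>\<^sup>2 * (\<tau> - \<sigma>)"
    by eventually_elim (use assms lrt_div_ge lrt_div_le in blast)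
qed auto

text \<open>Product rule for \<open>\<tau> * (lrt K \<mu>0 h \<tau> / \<tau>)\<close>, which agrees
  with \<open>lrt\<close> on the positive half-line.\<close>

lemma lrt_has_derivative:
  assumes "\<sigma> > 0"
  shows "(lrt K \<mu>0 h has_real_derivative (lrt K \<mu>0 h \<sigma> + err K \<mu>0 h \<sigma>) / \<sigma>) (at \<sigma>)"
proof -
  have "((\<lambda>\<tau>. \<tau> * (lrt K \<mu>0 h \<tau> / \<tau>)) has_real_derivative (lrt K \<mu>0 h \<sigma> + err K \<mu>0 h \<sigma>) / \<sigma>) (at \<sigma>)"
    by (rule derivative_eq_intros lrt_div_has_derivative assms refl)+
      (use assms in \<open>simp add: field_simps power2_eq_square\<close>)
  then show ?thesis
    by (rule has_field_derivative_transform_within_open[of _ _ _ "{0<..}"]) (use assms in auto)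
qed

lemma lrt_div_mono: "mono_on {0<..} (\<lambda>\<sigma>. lrt K \<mu>0 h \<sigma> / \<sigma>)"
proof (rule mono_onI)
  fix \<sigma> \<tau> :: real
  assume \<sigma>\<tau>: "\<sigma> \<in> {0<..}" "\<tau> \<in> {0<..}" "\<sigma> \<le> \<tau>"
  then have "err K \<mu>0 h \<sigma> * (1 / \<sigma> - 1 / \<tau>) \<ge> 0"
    by (intro mult_nonneg_nonneg) (auto simp: err_def frac_le)
  then show "lrt K \<mu>0 h \<sigma> / \<sigma> \<le> lrt K \<mu>0 h \<tau> / \<tau>"
    using lrt_div_ge[of \<sigma> \<tau>] \<sigma>\<tau> by auto
qed

lemma lrt_div_concave: "concave_on {0<..} (\<lambda>\<sigma>. lrt K \<mu>0 h \<sigma> / \<sigma>)"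
  by (rule concave_on_if_below_tangents[where D = "\<lambda>\<sigma>. err K \<mu>0 h \<sigma> / \<sigma>\<^sup>2"])
    (use lrt_div_le in auto)

text \<open>By convexity the rescaled sets \<open>(K - \<mu>0) / \<sigma>\<close> shrink as \<open>\<sigma>\<close> grows, and \<open>lrt \<sigma> / \<sigma>\<^sup>2\<close> is the
  maximum of a function independent of \<open>\<sigma>\<close> over them.\<close>
lemma lrt_div_square_antimono: "antimono_on {0<..} (\<lambda>\<sigma>. lrt K \<mu>0 h \<sigma> / \<sigma>\<^sup>2)"
proof (rule monotone_onI)
  fix \<sigma> \<tau> :: real
  assume "\<sigma> \<in> {0<..}" "\<tau> \<in> {0<..}" "\<sigma> \<le> \<tau>"
  then have pos: "\<sigma> > 0" "\<tau> > 0" and "\<sigma> \<le> \<tau>" by auto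
  define d where "d = mu_seq K \<mu>0 h \<tau> - \<mu>0"
  \<comment> \<open>This competitor at \<open>\<sigma>\<close> has displacement from
    \<open>\<mu>0\<close> equal to \<open>(\<sigma> / \<tau>) *\<^sub>R d\<close>, so its rescaled
    displacement is that of the maximiser at \<open>\<tau>\<close>.\<close>
  have "(1 - \<sigma> / \<tau>) *\<^sub>R \<mu>0 + (\<sigma> / \<tau>) *\<^sub>R mu_seq K \<mu>0 h \<tau> \<in> K"
    using K mu_seq_in pos \<open>\<sigma> \<le> \<tau>\<close> by (intro convexD) auto
  also have "(1 - \<sigma> / \<tau>) *\<^sub>R \<mu>0 + (\<sigma> / \<tau>) *\<^sub>R mu_seq K \<mu>0 h \<tau> = \<mu>0 + (\<sigma> / \<tau>) *\<^sub>R d"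
    by (simp add: d_def algebra_simps)
  finally have "lrt K \<mu>0 h \<sigma> \<ge> 2 * \<sigma> * (\<sigma> / \<tau> * (h \<bullet> d)) - (\<sigma> / \<tau>)\<^sup>2 * (norm d)\<^sup>2"
    using lrt_ge[of "\<mu>0 + (\<sigma> / \<tau>) *\<^sub>R d" \<sigma>]
    by (simp add: power_mult_distrib power_divide)
  then have "lrt K \<mu>0 h \<sigma> / \<sigma>\<^sup>2 \<ge> (2 * \<sigma> * (\<sigma> / \<tau> * (h \<bullet> d)) - (\<sigma> / \<tau>)\<^sup>2 * (norm d)\<^sup>2) / \<sigma>\<^sup>2"
    by (simp add: divide_right_mono)
  also have "(2 * \<sigma> * (\<sigma> / \<tau> * (h \<bullet> d)) - (\<sigma> / \<tau>)\<^sup>2 * (norm d)\<^sup>2) / \<sigma>\<^sup>2 = lrt K \<mu>0 h \<tau> / \<tau>\<^sup>2"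
    using pos by (simp add: lrt_eq err_def d_def field_simps power2_eq_square)
  finally show "lrt K \<mu>0 h \<sigma> / \<sigma>\<^sup>2 \<ge> lrt K \<mu>0 h \<tau> / \<tau>\<^sup>2" .
qed

text \<open>With the support function replaced by its candidate value at \<open>p - \<nu>\<close>,
  the shift cancels and completing the square in \<open>s\<close> exposes the residual as
  minimiser.\<close>

lemma lrt_dual:
  fixes \<sigma> :: real and \<nu> :: "real^'n"
  defines "p \<equiv> mu_seq K \<mu>0 h \<sigma>"
  shows "(norm (\<sigma> *\<^sub>R h - s))\<^sup>2 - 2 * (s \<bullet> (\<mu>0 - \<nu>) - (p - \<nu>) \<bullet> s)
    = lrt K \<mu>0 h \<sigma> + (norm (s - (\<mu>0 + \<sigma> *\<^sub>R h - p)))\<^sup>2"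
  unfolding lrt_def p_def[symmetric] power2_norm_eq_inner
  by (simp add: inner_simps inner_commute algebra_simps)

lemma lrt_le_dual_objective:
  assumes "mu_seq K \<mu>0 h \<sigma> - \<nu> \<in> K"
  shows "ereal (lrt K \<mu>0 h \<sigma>) \<le> dual_objective K \<mu>0 h \<sigma> \<nu> s"
proof -
  let ?p = "mu_seq K \<mu>0 h \<sigma>"
  have sup: "ereal ((?p - \<nu>) \<bullet> s) \<le> support_function K s"
    unfolding support_function_def using assms by (rule SUP_upper)
  have "lrt K \<mu>0 h \<sigma> \<le> (norm (\<sigma> *\<^sub>R h - s))\<^sup>2 - 2 * (s \<bullet> (\<mu>0 - \<nu>) - (?p - \<nu>) \<bullet> s)"
    unfolding lrt_dual by simp
  with sup show ?thesis
    \<comment> \<open>An infinite support function makes the objective infinite; the value minus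
      infinity contradicts \<open>sup\<close>.\<close>
    unfolding dual_objective_def by (cases "support_function K s") auto
qed

text \<open>\<open>K + \<nu> \<subseteq> K\<close> and \<open>mu_seq K \<mu>0 h \<sigma> - \<nu> \<in> K\<close> together force the residual to be orthogonal to \<open>\<nu>\<close>.\<close>
lemma lrt_eq_dual_objective:
  assumes shift: "(\<lambda>x. x + \<nu>) ` K \<subseteq> K" and diff: "mu_seq K \<mu>0 h \<sigma> - \<nu> \<in> K"
  shows "ereal (lrt K \<mu>0 h \<sigma>)
    = dual_objective K \<mu>0 h \<sigma> \<nu> (\<mu>0 + \<sigma> *\<^sub>R h - mu_seq K \<mu>0 h \<sigma>)"
proof -
  define p s where "p = mu_seq K \<mu>0 h \<sigma>" and "s = \<mu>0 + \<sigma> *\<^sub>R h - p"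
  have obtuse: "s \<bullet> (x - p) \<le> 0" if "x \<in> K" for x
    using mu_seq_obtuse[OF that] by (simp add: s_def p_def)
  have "p + \<nu> \<in> K" using shift mu_seq_in by (auto simp: p_def)
  \<comment> \<open>Both \<open>p + \<nu>\<close> and \<open>p - \<nu>\<close> lie in
    \<open>K\<close>, so the obtuse angle condition gives both signs.\<close>
  then have "s \<bullet> \<nu> = 0"
    using obtuse[of "p + \<nu>"] obtuse[of "p - \<nu>"] diff by (simp add: p_def)
  then have "x \<bullet> s \<le> (p - \<nu>) \<bullet> s" if "x \<in> K" for x
    using obtuse[OF that] by (simp add: inner_diff_right inner_diff_left inner_commute)
  \<comment> \<open>The supremum is attained at \<open>p - \<nu>\<close>, so \<open>lrt_dual\<close>
    applies with vanishing square.\<close>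
  then have "support_function K s = ereal ((p - \<nu>) \<bullet> s)"
    unfolding support_function_def using diff
    by (intro antisym SUP_least SUP_upper) (auto simp: p_def)
  then show ?thesis
    using lrt_dual[of \<sigma> s \<nu>]
    unfolding dual_objective_def p_def[symmetric] s_def[symmetric] by simp
qed

end

theorem lemma4p5:
  fixes K :: "(real^'n) set" and \<mu>0 h :: "real^'n"
  assumes "closed K" and "convex K" and "\<mu>0 \<in> K"
  shows
    "(\<forall>\<sigma>>0. lrt K \<mu>0 h field_differentiable at \<sigma> \<and>
        lrt K \<mu>0 h \<sigma> - \<sigma> * deriv (lrt K \<mu>0 h) \<sigma> = - err K \<mu>0 h \<sigma>)
   \<and> (\<forall>\<sigma>\<ge>0. \<forall>\<nu>. (\<lambda>x. x + \<nu>) ` K \<subseteq> K \<and> mu_seq K \<mu>0 h \<sigma> - \<nu> \<in> K \<longrightarrow>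
        (\<exists>s. ereal (lrt K \<mu>0 h \<sigma>) = dual_objective K \<mu>0 h \<sigma> \<nu> s) \<and>
        (\<forall>s. ereal (lrt K \<mu>0 h \<sigma>) \<le> dual_objective K \<mu>0 h \<sigma> \<nu> s))
   \<and> (\<forall>\<sigma>>0. ((\<lambda>\<tau>. lrt K \<mu>0 h \<tau> / \<tau>) has_real_derivative err K \<mu>0 h \<sigma> / \<sigma>\<^sup>2) (at \<sigma>))
   \<and> mono_on {0<..} (\<lambda>\<sigma>. lrt K \<mu>0 h \<sigma> / \<sigma>)
   \<and> concave_on {0<..} (\<lambda>\<sigma>. lrt K \<mu>0 h \<sigma> / \<sigma>)
   \<and> antimono_on {0<..} (\<lambda>\<sigma>. lrt K \<mu>0 h \<sigma> / \<sigma>\<^sup>2)"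
proof (intro conjI allI impI)
  fix \<sigma> :: real
  assume \<sigma>: "\<sigma> > 0"
  note D = lrt_has_derivative[OF assms \<sigma>, of h]
  show "lrt K \<mu>0 h field_differentiable at \<sigma>"
    using D by (auto simp: field_differentiable_def)
  show "lrt K \<mu>0 h \<sigma> - \<sigma> * deriv (lrt K \<mu>0 h) \<sigma> = - err K \<mu>0 h \<sigma>"
    using \<sigma> by (simp add: DERIV_imp_deriv[OF D])
  show "((\<lambda>\<tau>. lrt K \<mu>0 h \<tau> / \<tau>) has_real_derivative err K \<mu>0 h \<sigma> / \<sigma>\<^sup>2) (at \<sigma>)"
    by (rule lrt_div_has_derivative[OF assms \<sigma>])
next
  fix \<sigma> :: real and \<nu> s :: "real^'n"
  assume \<nu>: "(\<lambda>x. x + \<nu>) ` K \<subseteq> K \<and> mu_seq K \<mu>0 h \<sigma> - \<nu> \<in> K"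
  show "\<exists>s. ereal (lrt K \<mu>0 h \<sigma>) = dual_objective K \<mu>0 h \<sigma> \<nu> s"
    using lrt_eq_dual_objective[OF assms] \<nu> by blast
  show "ereal (lrt K \<mu>0 h \<sigma>) \<le> dual_objective K \<mu>0 h \<sigma> \<nu> s"
    using lrt_le_dual_objective[OF assms] \<nu> by blast
qed (rule lrt_div_mono[OF assms] lrt_div_concave[OF assms] lrt_div_square_antimono[OF assms])+

end
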